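(* Let $G\in\mathcal G$, i.e. $G$ is a graph (loops allowed) with no vertices $u_1,u_2,v_1,v_2\in V(G)$, $u_1\neq u_2$, $v_1\ne v_2$, such that $\{u_i,v_j\}\in E(G)$ for all $i,j\in\{1,2\}$. Any set-join cover $\mathscr C$ of $G$ has the following properties: (1) All elements of $\mathscr C$ are of the form $\{v\}\vee\mathcal K$ for some $v\in V(G)$. (2) Let $\mathcal K\in V(\mathscr C)$ with $|\mathcal K|\ge2$ and $\{v_1\}\vee\mathcal K\in\mathscr C$. Then: (a) $\{v_1\}\vee\mathcal K$ is the only element of $\mathscr C$ with a component $\mathcal K$. (b) If $\mathscr C$ is an optimal set-join cover of $G$ and $\{v_1\}\vee\mathcal L\in\mathscr C$ for some $\mathcal L\neq\mathcal K$, then $|\mathcal L|=1$. (3) If $\mathscr C$ is an optimal set-join cover of $G$, then any two (distinct) components in $V(\mathscr C)$ intersect in at most one vertex of $G$.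
   Context: Graphs are finite and undirected, without multiple edges, possibly with loops $\{u,u\}$. For nonempty $\mathcal K,\mathcal L\subseteq V(G)$ (possibly intersecting), the set-join $\mathcal K\vee\mathcal L=\mathcal L\vee\mathcal K$, with components $\mathcal K$ and $\mathcal L$, is the graph on $V(G)$ with edges $\{i,j\}$, $i\in\mathcal K$, $j\in\mathcal L$ (so it has a loop exactly at vertices of $\mathcal K\cap\mathcal L$). A set-join cover of $G$ is a set $\mathscr C=\{\mathcal K_i\vee\mathcal L_i:i\in[t]\}$ with $E(G)=\bigcup_{i}E(\mathcal K_i\vee\mathcal L_i)$. Its component set is $V(\mathscr C)=\{\mathcal K_i:i\in[t]\}\cup\{\mathcal L_i:i\in[t]\}$, and its order is $|V(\mathscr C)|$. A set-join cover is optimal if its order is minimum among all set-join covers of $G$. *)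

theory Defs
  imports Main
begin

text \<open>Finite undirected graphs without multiple edges. An edge is the set of its end vertices, so
  a loop at \<open>u\<close> is \<open>{u, u} = {u}\<close>.\<close>

record 'a graph =
  verts :: "'a set"
  edges :: "'a set set"

definition fin_graph :: "'a graph \<Rightarrow> bool" where
  "fin_graph G \<longleftrightarrow> finite (verts G) \<and> edges G \<subseteq> {{u, v} | u v. u \<in> verts G \<and> v \<in> verts G}"

definition in_class_G :: "'a graph \<Rightarrow> bool" where
  "in_class_G G \<longleftrightarrow> fin_graph G \<and>
     \<not> (\<exists>u1\<in>verts G. \<exists>u2\<in>verts G. \<exists>v1\<in>verts G. \<exists>v2\<in>verts G. u1 \<noteq> u2 \<and> v1 \<noteq> v2 \<and>
         {u1, v1} \<in> edges G \<and> {u1, v2} \<in> edges G \<and> {u2, v1} \<in> edges G \<and> {u2, v2} \<in> edges G)"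

definition set_join :: "'a graph \<Rightarrow> 'a set \<Rightarrow> 'a set \<Rightarrow> 'a graph" where
  "set_join G K L = \<lparr>verts = verts G, edges = {{i, j} | i j. i \<in> K \<and> j \<in> L}\<rparr>"

text \<open>\<open>H\<close> is the set-join \<open>K \<or> L\<close> of nonempty sets \<open>K\<close> and \<open>L\<close> of vertices of \<open>G\<close>. The graph \<open>H\<close>
  determines the unordered pair of its components, see \<open>set_join_components_unique\<close> below, so a
  set-join is identified with its graph.\<close>

definition is_set_join_of :: "'a graph \<Rightarrow> 'a graph \<Rightarrow> 'a set \<Rightarrow> 'a set \<Rightarrow> bool" where
  "is_set_join_of G H K L \<longleftrightarrow>
     K \<noteq> {} \<and> L \<noteq> {} \<and> K \<subseteq> verts G \<and> L \<subseteq> verts G \<and> H = set_join G K L"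

definition is_component :: "'a graph \<Rightarrow> 'a graph \<Rightarrow> 'a set \<Rightarrow> bool" where
  "is_component G H K \<longleftrightarrow> (\<exists>L. is_set_join_of G H K L)"

definition set_join_cover :: "'a graph \<Rightarrow> 'a graph set \<Rightarrow> bool" where
  "set_join_cover G C \<longleftrightarrow>
     (\<forall>H\<in>C. \<exists>K L. is_set_join_of G H K L) \<and> edges G = (\<Union>H\<in>C. edges H)"

text \<open>Since \<open>K \<or> L = L \<or> K\<close>, this collects both components of every element of \<open>C\<close>.\<close>

definition component_set :: "'a graph \<Rightarrow> 'a graph set \<Rightarrow> 'a set set" where
  "component_set G C = {K. \<exists>H\<in>C. is_component G H K}"

definition cover_order :: "'a graph \<Rightarrow> 'a graph set \<Rightarrow> nat" where
  "cover_order G C = card (component_set G C)"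

definition optimal_set_join_cover :: "'a graph \<Rightarrow> 'a graph set \<Rightarrow> bool" where
  "optimal_set_join_cover G C \<longleftrightarrow> set_join_cover G C \<and>
     (\<forall>D. set_join_cover G D \<longrightarrow> cover_order G C \<le> cover_order G D)"

lemma set_join_commute: "set_join G K L = set_join G L K"
  unfolding set_join_def by (auto simp: insert_commute)

lemma edge_set_join_iff:
  "{i, j} \<in> edges (set_join G K L) \<longleftrightarrow> i \<in> K \<and> j \<in> L \<or> i \<in> L \<and> j \<in> K"
  unfolding set_join_def by (auto simp: doubleton_eq_iff)

lemma set_join_components_unique:
  assumes "is_set_join_of G H K L" and "is_set_join_of G H K' L'"
  shows "{K, L} = {K', L'}"
proof -
  have e: "i \<in> K \<and> j \<in> L \<or> i \<in> L \<and> j \<in> K \<longleftrightarrow> i \<in> K' \<and> j \<in> L' \<or> i \<in> L' \<and> j \<in> K'" for i j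
    using assms edge_set_join_iff[of i j G] unfolding is_set_join_of_def by metis
  have ne: "K \<noteq> {}" "L \<noteq> {}" "K' \<noteq> {}" "L' \<noteq> {}"
    using assms unfolding is_set_join_of_def by auto
  have un: "K \<union> L = K' \<union> L'" using e ne by blast
  have int: "K \<inter> L = K' \<inter> L'" using e by blast
  have "K = K' \<and> L = L' \<or> K = L' \<and> L = K'"
  proof (cases "K \<subseteq> L \<or> L \<subseteq> K")
    case True
    then have "K' \<subseteq> L' \<or> L' \<subseteq> K'" using e int un by blast
    with True show ?thesis using int un by blast
  next
    case False
    then obtain k l where kl: "k \<in> K" "k \<notin> L" "l \<in> L" "l \<notin> K" by blast
    have "k \<in> K' \<and> k \<notin> L' \<and> l \<in> L' \<and> l \<notin> K' \<or> k \<in> L' \<and> k \<notin> K' \<and> l \<in> K' \<and> l \<notin> L'"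
      using kl e[of k l] e[of k k] e[of l l] by blast
    then show ?thesis
    proof
      assume "k \<in> K' \<and> k \<notin> L' \<and> l \<in> L' \<and> l \<notin> K'"
      then have "L = L'" "K = K'" using e[of k] e[of l] kl by blast+
      then show ?thesis by simp
    next
      assume "k \<in> L' \<and> k \<notin> K' \<and> l \<in> K' \<and> l \<notin> L'"
      then have "L = K'" "K = L'" using e[of k] e[of l] kl by blast+
      then show ?thesis by simp
    qed
  qed
  then show ?thesis by auto
qed

end

theory Submission
  imports Defs
begin

text \<open>A set-join whose components both have two vertices contains the forbidden configuration, and so
  do two set-joins \<open>{v} \<or> K\<close>, \<open>{w} \<or> L\<close> with \<open>v \<noteq> w\<close> and \<open>|K \<inter> L| \<ge> 2\<close>. If \<open>K \<noteq> L\<close> both have at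
  least two vertices, merging \<open>{v} \<or> K\<close> and \<open>{v} \<or> L\<close> into \<open>{v} \<or> (K \<union> L)\<close> makes the components
  \<open>K\<close> and \<open>L\<close> disappear while at most \<open>K \<union> L\<close> appears, so an optimal cover admits no such merge.\<close>

lemma two_le_card_obtain:
  assumes "2 \<le> card A"
  obtains x y where "x \<in> A" "y \<in> A" "x \<noteq> y"
proof -
  have "\<not> is_singleton A" "A \<noteq> {}"
    using assms by (auto simp: is_singleton_altdef)
  then show thesis
    using that by (metis is_singletonI')
qed

lemma edges_set_join_singleton: "edges (set_join G {v} K) = (\<lambda>k. {v, k}) ` K"
  unfolding set_join_def by auto

text \<open>A set-join determines the unordered pair of its components, so a single known
  representation of \<open>H\<close> decides which sets satisfy the existential
  \<open>is_component\<close>.\<close>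

lemma is_component_iff:
  assumes "is_set_join_of G H K L"
  shows "is_component G H M \<longleftrightarrow> M = K \<or> M = L"
proof
  assume "is_component G H M"
  then obtain N where "is_set_join_of G H M N"
    unfolding is_component_def by blast
  from set_join_components_unique[OF this assms] show "M = K \<or> M = L"
    by (auto simp: doubleton_eq_iff)
next
  have "is_set_join_of G H L K"
    using assms set_join_commute[of G] unfolding is_set_join_of_def by auto
  then show "M = K \<or> M = L \<Longrightarrow> is_component G H M"
    using assms unfolding is_component_def by blast
qed

lemma edge_subset_verts: "fin_graph G \<Longrightarrow> e \<in> edges G \<Longrightarrow> e \<subseteq> verts G"
  unfolding fin_graph_def by blast

text \<open>End vertices of edges lie in \<open>verts G\<close>, so the bounded quantifiers in
  \<open>in_class_G\<close> are met by the edges alone.\<close>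

lemma in_class_G_no_biclique:
  assumes "in_class_G G" "v \<noteq> w" "k \<noteq> l"
    and "{v, k} \<in> edges G" "{v, l} \<in> edges G" "{w, k} \<in> edges G" "{w, l} \<in> edges G"
  shows False
proof -
  have "e \<subseteq> verts G" if "e \<in> edges G" for e
    using assms(1) that edge_subset_verts unfolding in_class_G_def by blast
  then have "v \<in> verts G" "w \<in> verts G" "k \<in> verts G" "l \<in> verts G"
    using assms(4-7) by blast+
  then show False
    using assms unfolding in_class_G_def by blast
qed

lemma set_join_cover_edge:
  assumes "set_join_cover G C" "set_join G K L \<in> C" "i \<in> K" "j \<in> L"
  shows "{i, j} \<in> edges G"
  using assms edge_set_join_iff[of i j G K L] unfolding set_join_cover_def by blast

lemma finite_component_set:
  assumes "finite (verts G)"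
  shows "finite (component_set G C)"
proof (rule finite_subset)
  show "component_set G C \<subseteq> Pow (verts G)"
    unfolding component_set_def is_component_def is_set_join_of_def by blast
qed (use assms in simp)

context
  fixes G :: "'a graph" and C :: "'a graph set"
  assumes G: "in_class_G G" and cover: "set_join_cover G C"
begin

lemma verts_finite: "finite (verts G)"
  using G unfolding in_class_G_def fin_graph_def by blast

lemma component_card_1:
  assumes "H \<in> C" "is_set_join_of G H K L"
  shows "card K = 1 \<or> card L = 1"
proof (rule ccontr)
  assume neg: "\<not> ?thesis"
  have KL: "K \<noteq> {}" "L \<noteq> {}" "finite K" "finite L" "set_join G K L \<in> C"
    using assms verts_finite unfolding is_set_join_of_def by (auto intro: finite_subset)
  \<comment> \<open>\<open>card\<close> is 0 only for empty or infinite sets; with both excluded,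
    differing from 1 means at least 2.\<close>
  have "card K \<noteq> 0" "card L \<noteq> 0"
    using KL by auto
  with neg have "2 \<le> card K" "2 \<le> card L"
    by linarith+
  then obtain v w k l where "v \<in> K" "w \<in> K" "v \<noteq> w" "k \<in> L" "l \<in> L" "k \<noteq> l"
    by (meson two_le_card_obtain)
  then show False
    using in_class_G_no_biclique[OF G] set_join_cover_edge[OF cover KL(5)] by blast
qed

lemma element_is_star:
  assumes "H \<in> C"
  obtains v K where "is_set_join_of G H {v} K"
proof -
  obtain K L where KL: "is_set_join_of G H K L"
    using assms cover unfolding set_join_cover_def by blast
  then have LK: "is_set_join_of G H L K"
    using set_join_commute[of G] unfolding is_set_join_of_def by auto
  show thesis
    using component_card_1[OF assms KL] KL LK that by (metis card_1_singletonE)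
qed

lemma star_of_component:
  assumes "H \<in> C" "is_component G H K" "2 \<le> card K"
  obtains v where "H = set_join G {v} K"
proof -
  obtain L where L: "is_set_join_of G H K L"
    using assms(2) unfolding is_component_def by blast
  then have "card L = 1"
    using component_card_1[OF assms(1)] assms(3) by fastforce
  then obtain v where "L = {v}"
    by (rule card_1_singletonE)
  then show thesis
    using that L set_join_commute[of G] unfolding is_set_join_of_def by auto
qed

text \<open>The cover only provides some pair of components for its element; \<open>{v}\<close> and
  \<open>K\<close> themselves must be shown to be an admissible pair. An empty \<open>K\<close>
  would leave no edges, and each \<open>{v, k}\<close> is an edge of \<open>G\<close>, which puts
  \<open>v\<close> and \<open>k\<close> among its vertices.\<close>

lemma star_is_set_join_of:
  assumes "set_join G {v} K \<in> C"
  shows "is_set_join_of G (set_join G {v} K) {v} K"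
proof -
  have "edges (set_join G {v} K) \<noteq> {}"
  proof -
    obtain A B where "is_set_join_of G (set_join G {v} K) A B"
      using assms cover unfolding set_join_cover_def by blast
    then show ?thesis
      unfolding is_set_join_of_def by (auto simp: set_join_def)
  qed
  then have "K \<noteq> {}"
    by (simp add: edges_set_join_singleton)
  moreover have "{v, k} \<subseteq> verts G" if "k \<in> K" for k
  proof (rule edge_subset_verts)
    show "fin_graph G"
      using G unfolding in_class_G_def by blast
    show "{v, k} \<in> edges G"
      using set_join_cover_edge[OF cover assms _ that] by simp
  qed
  ultimately show ?thesis
    unfolding is_set_join_of_def by auto
qed

text \<open>The case \<open>K = L\<close> yields uniqueness of the element with component
  \<open>K\<close>; the case \<open>K \<noteq> L\<close> gives two overlapping stars a common
  centre, so that they can be merged.\<close>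

lemma star_centre_unique:
  assumes "set_join G {v} K \<in> C" "set_join G {w} L \<in> C" "2 \<le> card (K \<inter> L)"
  shows "v = w"
proof (rule ccontr)
  assume "v \<noteq> w"
  obtain k l where "k \<in> K \<inter> L" "l \<in> K \<inter> L" "k \<noteq> l"
    using assms(3) by (rule two_le_card_obtain)
  then show False
    using in_class_G_no_biclique[OF G \<open>v \<noteq> w\<close>, of k l]
      set_join_cover_edge[OF cover assms(1)] set_join_cover_edge[OF cover assms(2)]
    by blast
qed

lemma component_in_unique_element:
  assumes "set_join G {v} K \<in> C" "2 \<le> card K" "H \<in> C" "is_component G H K"
  shows "H = set_join G {v} K"
proof -
  obtain w where "H = set_join G {w} K"
    using star_of_component[OF assms(3,4,2)] .
  then show ?thesis
    using star_centre_unique[of v K w K] assms by simp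
qed

lemma optimal_star_card:
  assumes opt: "optimal_set_join_cover G C"
    and K: "set_join G {v} K \<in> C" "2 \<le> card K"
    and L: "set_join G {v} L \<in> C" and "L \<noteq> K"
  shows "card L = 1"
proof (rule ccontr)
  assume "card L \<noteq> 1"
  note sK = star_is_set_join_of[OF K(1)] and sL = star_is_set_join_of[OF L]
  have "card L \<noteq> 0"
    using sL verts_finite unfolding is_set_join_of_def by (auto dest: finite_subset)
  with \<open>card L \<noteq> 1\<close> have L2: "2 \<le> card L"
    by linarith
  define N where "N = set_join G {v} (K \<union> L)"
  \<comment> \<open>\<open>N\<close> is inserted after the removal, so it stays in \<open>D\<close>
    even when \<open>K \<union> L\<close> equals \<open>K\<close> or \<open>L\<close>.\<close>
  define D where "D = insert N (C - {set_join G {v} K, set_join G {v} L})"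
  have sN: "is_set_join_of G N {v} (K \<union> L)"
    using sK sL unfolding N_def is_set_join_of_def by blast
  have "edges N = edges (set_join G {v} K) \<union> edges (set_join G {v} L)"
    unfolding N_def edges_set_join_singleton by blast
  then have "(\<Union>H\<in>D. edges H) = (\<Union>H\<in>C. edges H)"
    using K(1) L unfolding D_def by blast
  then have "set_join_cover G D"
    using cover sN unfolding set_join_cover_def D_def by blast
  then have le: "card (component_set G C) \<le> card (component_set G D)"
    using opt unfolding optimal_set_join_cover_def cover_order_def by blast
  have KL: "K \<in> component_set G C" "L \<in> component_set G C" "{v} \<in> component_set G C"
    using is_component_iff[OF sK] is_component_iff[OF sL] K(1) L
    unfolding component_set_def by auto
  \<comment> \<open>The centre \<open>{v}\<close> costs nothing: it is already a component of
    \<open>C\<close> and is too small to be \<open>K\<close> or \<open>L\<close>.\<close>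
  have "component_set G D \<subseteq> insert (K \<union> L) (component_set G C - {K, L})"
  proof
    fix M assume "M \<in> component_set G D"
    then obtain H where H: "H \<in> D" "is_component G H M"
      unfolding component_set_def by blast
    show "M \<in> insert (K \<union> L) (component_set G C - {K, L})"
    proof (cases "H = N")
      case True
      then have "M = {v} \<or> M = K \<union> L"
        using H(2) is_component_iff[OF sN] by simp
      moreover have "{v} \<noteq> K" "{v} \<noteq> L"
        using K(2) L2 by auto
      ultimately show ?thesis
        using KL(3) by blast
    next
      case False
      then have HC: "H \<in> C" "H \<noteq> set_join G {v} K" "H \<noteq> set_join G {v} L"
        using H(1) unfolding D_def by auto
      \<comment> \<open>Both sets have at least two vertices, so each is a component of only one
        element of \<open>C\<close>, and that element was removed.\<close>
      then have "M \<noteq> K" "M \<noteq> L"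
        using component_in_unique_element[OF K HC(1)] component_in_unique_element[OF L L2 HC(1)] H(2)
        by auto
      then show ?thesis
        using HC(1) H(2) unfolding component_set_def by blast
    qed
  qed
  then have "card (component_set G D) \<le> card (insert (K \<union> L) (component_set G C - {K, L}))"
    using finite_component_set[OF verts_finite] by (intro card_mono) auto
  also have "\<dots> \<le> Suc (card (component_set G C - {K, L}))"
    by (rule card_insert_le_m1) auto
  also have "card (component_set G C - {K, L}) = card (component_set G C) - 2"
    using KL \<open>L \<noteq> K\<close> by (subst card_Diff_subset) auto
  finally have "card (component_set G D) \<le> Suc (card (component_set G C) - 2)" .
  \<comment> \<open>Subtraction on naturals truncates; only with at least two components in
    \<open>C\<close> is \<open>Suc (n - 2)\<close> smaller than \<open>n\<close>.\<close>
  moreover have "card {K, L} \<le> card (component_set G C)"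
    using KL finite_component_set[OF verts_finite] by (intro card_mono) auto
  ultimately show False
    using le \<open>L \<noteq> K\<close> by simp
qed

text \<open>Two common vertices make both components large, hence leaves of stars, and force these
  stars to share their centre; \<open>optimal_star_card\<close> then bounds one of them by a single
  vertex.\<close>

lemma optimal_component_inter:
  assumes opt: "optimal_set_join_cover G C"
    and K: "K \<in> component_set G C" and L: "L \<in> component_set G C" and "K \<noteq> L"
  shows "card (K \<inter> L) \<le> 1"
proof (rule ccontr)
  assume "\<not> ?thesis"
  then have KL2: "2 \<le> card (K \<inter> L)"
    by simp
  obtain H H' where H: "H \<in> C" "is_component G H K" and H': "H' \<in> C" "is_component G H' L"
    using K L unfolding component_set_def by blast
  have "finite K" "finite L"
    using H(2) H'(2) verts_finite unfolding is_component_def is_set_join_of_def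
    by (auto intro: finite_subset)
  then have K2: "2 \<le> card K" and L2: "2 \<le> card L"
    using KL2 card_mono[of K "K \<inter> L"] card_mono[of L "K \<inter> L"] by auto
  obtain v w where v: "set_join G {v} K \<in> C" and w: "set_join G {w} L \<in> C"
    using star_of_component[OF H K2] star_of_component[OF H' L2] H(1) H'(1) by metis
  then have "v = w"
    using KL2 by (rule star_centre_unique)
  then show False
    using optimal_star_card[OF opt v K2] w \<open>K \<noteq> L\<close> L2 by auto
qed

end

theorem proposition3p2:
  fixes G :: "'a graph" and C :: "'a graph set"
  assumes "in_class_G G" and "set_join_cover G C"
  shows
    "(\<forall>H\<in>C. \<exists>v K. is_set_join_of G H {v} K) \<and>
     (\<forall>K v1. K \<in> component_set G C \<and> card K \<ge> 2 \<and> set_join G {v1} K \<in> C \<longrightarrow>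
        (\<forall>H\<in>C. is_component G H K \<longrightarrow> H = set_join G {v1} K) \<and>
        (optimal_set_join_cover G C \<longrightarrow>
           (\<forall>L. set_join G {v1} L \<in> C \<and> L \<noteq> K \<longrightarrow> card L = 1))) \<and>
     (optimal_set_join_cover G C \<longrightarrow>
        (\<forall>K\<in>component_set G C. \<forall>L\<in>component_set G C. K \<noteq> L \<longrightarrow> card (K \<inter> L) \<le> 1))"
proof (intro conjI ballI allI impI; (elim conjE)?)
  show "\<exists>v K. is_set_join_of G H {v} K" if "H \<in> C" for H
    by (rule element_is_star[OF assms that]) blast
  show "H = set_join G {v} K"
    if "2 \<le> card K" "set_join G {v} K \<in> C" "H \<in> C" "is_component G H K" for H K v
    using component_in_unique_element[OF assms] that by simp
  show "card L = 1"
    if "optimal_set_join_cover G C" "2 \<le> card K" "set_join G {v} K \<in> C"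
      "set_join G {v} L \<in> C" "L \<noteq> K" for K L v
    using optimal_star_card[OF assms that(1,3,2,4,5)] .
  show "card (K \<inter> L) \<le> 1"
    if "optimal_set_join_cover G C" "K \<in> component_set G C" "L \<in> component_set G C" "K \<noteq> L"
    for K L
    using optimal_component_inter[OF assms that] .
qed

end
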